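(* Let $A,B,B',C,C'\in\widehat{\mathbb{F}_q}$, $x,y\in\mathbb{F}_q$ and $t\in\mathbb{F}_q\setminus\{1\}$. Below, $\theta$ ranges over all multiplicative characters of $\mathbb{F}_q$. If $x\neq 1$, then $$\frac{1}{q-1}\sum_{\theta}\binom{B\overline{C}\theta}{\theta}F_{2}(A;B\theta,B';C,C';x,y)\,\theta(t)=\varepsilon(t)\,\overline{B}(1-t)\,F_{2}\left(A;B,B';C,C';\frac{x}{1-t},y\right)$$ $$\qquad-\overline{B}C(-t)\,\varepsilon(x)\,\overline{A}(1-x)\,{}_{2}F_1\left(\begin{matrix}A,B'\\ C'\end{matrix}\bigg|\,\frac{y}{1-x}\right).$$ If $y\neq 1$, then $$\frac{1}{q-1}\sum_{\theta}\binom{B'\overline{C'}\theta}{\theta}F_{2}(A;B,B'\theta;C,C';x,y)\,\theta(t)=\varepsilon(t)\,\overline{B'}(1-t)\,F_{2}\left(A;B,B';C,C';x,\frac{y}{1-t}\right)$$ $$\qquad-\overline{B'}C'(-t)\,\varepsilon(y)\,\overline{A}(1-y)\,{}_{2}F_1\left(\begin{matrix}A,B\\ C\end{matrix}\bigg|\,\frac{x}{1-y}\right).$$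
   Context: Let $q$ be a power of a prime, $\mathbb{F}_q$ the field with $q$ elements, and $\widehat{\mathbb{F}_q}$ the group of (complex-valued) multiplicative characters of $\mathbb{F}_q^*$. Every character $\chi$, including the trivial character $\varepsilon$, is extended to $\mathbb{F}_q$ by $\chi(0)=0$. $\overline{\chi}$ denotes the inverse of $\chi$. Products of characters are evaluated pointwise, e.g. $\overline{B}C(-t)=\overline{B}(-t)C(-t)$. Jacobi sum: $J(\chi,\lambda)=\sum_{u\in\mathbb{F}_q}\chi(u)\lambda(1-u)$. Binomial coefficient of characters: $\binom{A}{B}=B(-1)J(A,\overline{B})$. Finite field ${}_2F_1$: for $A,B,C\in\widehat{\mathbb{F}_q}$ and $x\in\mathbb{F}_q$, $${}_{2}F_1\left(\begin{matrix}A,B\\ C\end{matrix}\bigg|\,x\right)=\varepsilon(x)\,BC(-1)\sum_{u\in\mathbb{F}_q}B(u)\,\overline{B}C(1-u)\,\overline{A}(1-xu).$$ The finite field Appell series $F_2$ is defined, for $A,B,B',C,C'\in\widehat{\mathbb{F}_q}$ and $x,y\in\mathbb{F}_q$, by $$F_{2}(A;B,B';C,C';x,y)=\varepsilon(xy)\,BB'CC'(-1)\sum_{u,v\in\mathbb{F}_q}B(u)B'(v)\,\overline{B}C(1-u)\,\overline{B'}C'(1-v)\,\overline{A}(1-ux-vy).$$ *)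

theory Defs
  imports Complex_Main "HOL-Library.Cardinality" "HOL-Library.FuncSet"
begin

text \<open>
  The field with \<open>q\<close> elements is a type \<open>'a :: {field, finite}\<close> with \<open>CARD('a) = q\<close>; that \<open>q\<close> is a
  prime power is then automatic. A multiplicative character is represented by its extension
  by zero to the whole field; this applies to the trivial character as well, so it vanishes at 0.
\<close>

definition mult_chars :: "('a :: {field, finite} \<Rightarrow> complex) set" where
  "mult_chars = {\<chi>. \<chi> 0 = 0 \<and> (\<forall>x. x \<noteq> 0 \<longrightarrow> \<chi> x \<noteq> 0) \<and>
                    (\<forall>x y. x \<noteq> 0 \<longrightarrow> y \<noteq> 0 \<longrightarrow> \<chi> (x * y) = \<chi> x * \<chi> y)}"

definition triv_char :: "'a :: {field, finite} \<Rightarrow> complex" where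
  "triv_char x = (if x = 0 then 0 else 1)"

definition char_mult ::
  "('a :: {field, finite} \<Rightarrow> complex) \<Rightarrow> ('a \<Rightarrow> complex) \<Rightarrow> 'a \<Rightarrow> complex" (infixl "\<odot>" 70) where
  "(\<chi> \<odot> \<psi>) x = \<chi> x * \<psi> x"

text \<open>The group inverse; since \<open>inverse 0 = 0\<close>, it again vanishes at 0.\<close>

definition char_inv :: "('a :: {field, finite} \<Rightarrow> complex) \<Rightarrow> 'a \<Rightarrow> complex" where
  "char_inv \<chi> x = inverse (\<chi> x)"

definition jacobi_sum ::
  "('a :: {field, finite} \<Rightarrow> complex) \<Rightarrow> ('a \<Rightarrow> complex) \<Rightarrow> complex" where
  "jacobi_sum \<chi> \<psi> = (\<Sum>u\<in>UNIV. \<chi> u * \<psi> (1 - u))"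

definition char_binom ::
  "('a :: {field, finite} \<Rightarrow> complex) \<Rightarrow> ('a \<Rightarrow> complex) \<Rightarrow> complex" where
  "char_binom A B = B (- 1) * jacobi_sum A (char_inv B)"

definition hyp2F1 ::
  "('a :: {field, finite} \<Rightarrow> complex) \<Rightarrow> ('a \<Rightarrow> complex) \<Rightarrow> ('a \<Rightarrow> complex) \<Rightarrow> 'a \<Rightarrow> complex" where
  "hyp2F1 A B C x =
     triv_char x * (B \<odot> C) (- 1) *
     (\<Sum>u\<in>UNIV. B u * (char_inv B \<odot> C) (1 - u) * char_inv A (1 - x * u))"

text \<open>The arguments are in the order \<open>A; B, B'; C, C'; x, y\<close>.\<close>

definition appell_F2 ::
  "('a :: {field, finite} \<Rightarrow> complex) \<Rightarrow> ('a \<Rightarrow> complex) \<Rightarrow> ('a \<Rightarrow> complex) \<Rightarrow>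
   ('a \<Rightarrow> complex) \<Rightarrow> ('a \<Rightarrow> complex) \<Rightarrow> 'a \<Rightarrow> 'a \<Rightarrow> complex" where
  "appell_F2 A B B' C C' x y =
     triv_char (x * y) * (B \<odot> B' \<odot> C \<odot> C') (- 1) *
     (\<Sum>u\<in>UNIV. \<Sum>v\<in>UNIV. B u * B' v * (char_inv B \<odot> C) (1 - u) * (char_inv B' \<odot> C') (1 - v) *
        char_inv A (1 - u * x - v * y))"

text \<open>
  The character group is finite, so sums over \<^const>\<open>mult_chars\<close> are genuine finite sums
  (and not 0 by the convention for infinite index sets).
\<close>

lemma finite_mult_chars: "finite (mult_chars :: ('a :: {field, finite} \<Rightarrow> complex) set)"
proof -
  define n where "n = card (UNIV - {0 :: 'a})"
  have "(1 :: 'a) \<in> UNIV - {0}" by simp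
  hence n: "n > 0" unfolding n_def by (metis card_gt_0_iff empty_iff finite)
  define S where "S = insert 0 {z :: complex. z ^ n = 1}"
  have "finite S"
    unfolding S_def using finite_roots_unity[of n, where ?'a = complex] n by simp
  hence fin: "finite (UNIV \<rightarrow>\<^sub>E S :: ('a \<Rightarrow> complex) set)" by (intro finite_PiE) auto
  have "\<chi> x \<in> S" if \<chi>: "\<chi> \<in> mult_chars" for \<chi> :: "'a \<Rightarrow> complex" and x
  proof (cases "x = 0")
    case True
    thus ?thesis using \<chi> by (simp add: S_def mult_chars_def)
  next
    case False
    have "(\<Prod>y\<in>UNIV-{0}. \<chi> y) = (\<Prod>y\<in>UNIV-{0}. \<chi> (x * y))"
      by (rule prod.reindex_bij_witness[of _ "\<lambda>y. x * y" "\<lambda>y. y / x"]) (use False in auto)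
    also have "\<dots> = (\<Prod>y\<in>UNIV-{0}. \<chi> x * \<chi> y)"
      using \<chi> False by (intro prod.cong) (auto simp: mult_chars_def)
    also have "\<dots> = \<chi> x ^ n * (\<Prod>y\<in>UNIV-{0}. \<chi> y)"
      by (simp add: prod.distrib n_def)
    finally have "\<chi> x ^ n * (\<Prod>y\<in>UNIV-{0}. \<chi> y) = 1 * (\<Prod>y\<in>UNIV-{0}. \<chi> y)" by simp
    moreover have "(\<Prod>y\<in>UNIV-{0}. \<chi> y) \<noteq> 0"
      using \<chi> by (simp add: mult_chars_def)
    ultimately show ?thesis by (simp add: S_def)
  qed
  hence "mult_chars \<subseteq> (UNIV \<rightarrow>\<^sub>E S :: ('a \<Rightarrow> complex) set)" by auto
  thus ?thesis using fin finite_subset by blast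
qed

end

theory Submission
  imports Defs "HOL-Algebra.Algebraic_Closure_Type" "HOL-Library.Real_Mod"
begin

text \<open>
  Writing the binomial coefficient as a sum over \<open>w\<close> and summing over \<open>\<theta>\<close> first, orthogonality of
  characters forces \<open>w u t = (1 - w) (1 - u)\<close>, which determines \<open>w\<close> from \<open>u\<close>. What remains is the
  defining sum of \<open>F\<^sub>2\<close> with the factor at \<open>1 - u\<close> moved to \<open>1 - u (1 - t)\<close> and without the term
  \<open>u = 1\<close>: substituting \<open>u / (1 - t)\<close> for \<open>u\<close> gives the main term, and the missing term at \<open>u = 1\<close>
  is the \<open>\<^sub>2F\<^sub>1\<close>. The second identity is the first one with the two variables exchanged.
\<close>

no_notation Module.smult (infixl "\<odot>\<index>" 70)

section \<open>Multiplicative characters\<close>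

lemma mult_chars_zero: "\<chi> \<in> mult_chars \<Longrightarrow> \<chi> 0 = 0"
  by (simp add: mult_chars_def)

lemma mult_chars_eq_0_iff: "\<chi> \<in> mult_chars \<Longrightarrow> \<chi> x = 0 \<longleftrightarrow> x = 0"
  by (auto simp: mult_chars_def)

lemma mult_chars_mult: "\<chi> \<in> mult_chars \<Longrightarrow> \<chi> (x * y) = \<chi> x * \<chi> y"
  by (cases "x = 0"; cases "y = 0") (auto simp: mult_chars_def)

lemma mult_chars_one: "\<chi> \<in> mult_chars \<Longrightarrow> \<chi> 1 = 1"
  using mult_chars_mult[of \<chi> 1 1] mult_chars_eq_0_iff[of \<chi> 1] by simp

lemma mult_chars_inverse: "\<chi> \<in> mult_chars \<Longrightarrow> \<chi> (inverse x) = inverse (\<chi> x)"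
proof (cases "x = 0")
  case False
  assume \<chi>: "\<chi> \<in> mult_chars"
  have "\<chi> x * \<chi> (inverse x) = 1"
    using \<chi> False by (simp add: mult_chars_one flip: mult_chars_mult)
  thus ?thesis by (metis inverse_unique)
qed (simp add: mult_chars_zero)

lemma mult_chars_divide: "\<chi> \<in> mult_chars \<Longrightarrow> \<chi> (x / y) = \<chi> x / \<chi> y"
  by (simp add: divide_inverse mult_chars_mult mult_chars_inverse)

lemma mult_chars_minus_one_square: "\<chi> \<in> mult_chars \<Longrightarrow> \<chi> (- 1) * \<chi> (- 1) = 1"
  by (simp add: mult_chars_one flip: mult_chars_mult)

lemma inverse_mult_chars_minus_one:
  "\<chi> \<in> mult_chars \<Longrightarrow> inverse (\<chi> (- 1)) = \<chi> (- 1)"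
  using mult_chars_minus_one_square by (metis inverse_unique)

lemma char_mult_in_mult_chars [intro]:
  "\<chi> \<in> mult_chars \<Longrightarrow> \<psi> \<in> mult_chars \<Longrightarrow> \<chi> \<odot> \<psi> \<in> mult_chars"
  by (simp add: mult_chars_def char_mult_def)

lemma char_inv_in_mult_chars [intro]: "\<chi> \<in> mult_chars \<Longrightarrow> char_inv \<chi> \<in> mult_chars"
  by (simp add: mult_chars_def char_inv_def)

lemma triv_char_in_mult_chars [intro]: "triv_char \<in> mult_chars"
  by (simp add: mult_chars_def triv_char_def)

section \<open>Orthogonality\<close>

text \<open>The multiplicative group of a finite field is cyclic; \<open>n\<close> is the order of a
  generator. Knowing which exponents give 1 suffices to copy the group into the complex
  numbers.\<close>

lemma finite_field_primitive_element:
  obtains g :: "'a :: {field, finite}" and n :: nat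
  where "g \<noteq> 0" and "\<forall>x. x \<noteq> 0 \<longrightarrow> (\<exists>i. x = g ^ i)" and "n > 0"
    and "\<forall>i. g ^ i = 1 \<longleftrightarrow> n dvd i"
proof -
  define R :: "'a ring" where "R = ring_of_type_algebra"
  let ?M = "Multiplicative_Group.mult_of R"
  interpret field R unfolding R_def by (rule field_from_type_algebra)
  interpret G: group ?M by (rule field_mult_group)
  have carrier: "carrier ?M = UNIV - {0}"
    by (simp add: R_def ring_of_type_algebra_def)
  have pow: "x [^]\<^bsub>?M\<^esub> i = x ^ i" for x :: 'a and i :: nat
    by (induction i) (simp_all add: R_def ring_of_type_algebra_def mult.commute)
  have one: "\<one>\<^bsub>?M\<^esub> = 1"
    by (simp add: R_def ring_of_type_algebra_def)
  obtain g where g: "g \<in> carrier ?M"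
    and gen: "carrier ?M = {g [^]\<^bsub>R\<^esub> i | i::nat. i \<in> UNIV}"
    using finite_field_mult_group_has_gen by auto
  show ?thesis
  proof (rule that[of g "G.ord g"])
    show "g \<noteq> 0" using g unfolding carrier by blast
    show "\<forall>x. x \<noteq> 0 \<longrightarrow> (\<exists>i. x = g ^ i)"
      using gen unfolding carrier Multiplicative_Group.nat_pow_mult_of[symmetric] pow by blast
    show "G.ord g > 0"
      using G.ord_ge_1[OF _ g] unfolding carrier by simp
    show "\<forall>i. g ^ i = 1 \<longleftrightarrow> G.ord g dvd i"
      using G.pow_eq_id[OF g] unfolding pow one by blast
  qed
qed

lemma cis_root_power_eq_1_iff:
  assumes "n > 0"
  shows "cis (2 * pi / real n) ^ i = 1 \<longleftrightarrow> n dvd i"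
proof -
  have "cis (2 * pi / real n) ^ i = 1 \<longleftrightarrow> (\<exists>m::int. real i * (2 * pi / real n) = of_int m * (2 * pi))"
    by (simp only: DeMoivre cis_eq_1_iff)
  also have "\<dots> \<longleftrightarrow> (\<exists>m::int. real_of_int (int i) = real_of_int (int n * m))"
    using assms by (simp add: field_simps)
  also have "\<dots> \<longleftrightarrow> int n dvd int i"
    by (simp only: of_int_eq_iff dvd_def)
  finally show ?thesis by simp
qed

text \<open>Coincidences between powers depend only on the order, so they carry over from a field
  element to a complex root of unity of the same order.\<close>

lemma power_eq_power_iff_dvd:
  fixes a :: "'b :: field"
  assumes "a \<noteq> 0" "\<And>i::nat. a ^ i = 1 \<longleftrightarrow> n dvd i" "i \<le> j"
  shows "a ^ i = a ^ j \<longleftrightarrow> n dvd (j - i)"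
proof -
  have "a ^ j = a ^ i * a ^ (j - i)"
    using assms(3) by (simp flip: power_add)
  thus ?thesis using assms(1,2) by auto
qed

text \<open>Sending a generator \<open>g\<close> of order \<open>n\<close> to a primitive
  \<open>n\<close>-th root of unity gives an injective character, so one character serves for every
  \<open>z\<close>.\<close>

lemma mult_chars_separate:
  fixes z :: "'a :: {field, finite}"
  assumes "z \<noteq> 0" "z \<noteq> 1"
  obtains \<chi> where "\<chi> \<in> mult_chars" "\<chi> z \<noteq> 1"
proof -
  obtain g :: 'a and n where g: "g \<noteq> 0" "\<forall>x. x \<noteq> 0 \<longrightarrow> (\<exists>i. x = g ^ i)" "n > 0"
      "\<forall>i. g ^ i = 1 \<longleftrightarrow> n dvd i"
    using finite_field_primitive_element by blast
  define \<omega> where "\<omega> = cis (2 * pi / real n)"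
  have \<omega>: "\<omega> \<noteq> 0" "\<And>i. \<omega> ^ i = 1 \<longleftrightarrow> n dvd i"
    using cis_root_power_eq_1_iff[OF g(3)] by (simp_all add: \<omega>_def)
  have same: "g ^ i = g ^ j \<longleftrightarrow> \<omega> ^ i = \<omega> ^ j" for i j
    using power_eq_power_iff_dvd[OF g(1) g(4)[rule_format]] power_eq_power_iff_dvd[OF \<omega>]
    by (metis nat_le_linear)
  \<comment> \<open>An arbitrarily chosen discrete logarithm to base \<open>g\<close>; by
    \<open>same\<close>, the resulting power of \<open>\<omega>\<close> does not depend on the
    choice.\<close>
  define l where "l x = (SOME i. x = g ^ i)" for x
  define \<chi> where "\<chi> x = (if x = 0 then 0 else \<omega> ^ l x)" for x
  have l: "g ^ l x = x" if "x \<noteq> 0" for x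
    using someI_ex[OF g(2)[rule_format, OF that]] by (simp add: l_def)
  have "\<omega> ^ l (x * y) = \<omega> ^ l x * \<omega> ^ l y" if "x \<noteq> 0" "y \<noteq> 0" for x y
  proof -
    \<comment> \<open>The exponents themselves need not add up; the powers of \<open>g\<close>
      agree, and \<open>same\<close> transfers this to \<open>\<omega>\<close>.\<close>
    have "g ^ l (x * y) = g ^ (l x + l y)"
      using that by (simp add: l power_add)
    thus ?thesis unfolding same by (simp add: power_add)
  qed
  hence "\<chi> \<in> mult_chars"
    using \<omega>(1) by (simp add: mult_chars_def \<chi>_def)
  moreover have "\<chi> z \<noteq> 1"
    using same[of "l z" 0] l[of z] assms by (simp add: \<chi>_def)
  ultimately show ?thesis using that by blast
qed

section \<open>The two orthogonality relations\<close>

text \<open>Replacing \<open>z\<close> by \<open>a * z\<close> permutes the field and multiplies the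
  sum by \<open>\<chi> a\<close>, which is not 1.\<close>

lemma sum_nontrivial_char:
  fixes \<chi> :: "'a :: {field, finite} \<Rightarrow> complex"
  assumes "\<chi> \<in> mult_chars" "a \<noteq> 0" "\<chi> a \<noteq> 1"
  shows "(\<Sum>z\<in>UNIV. \<chi> z) = 0"
proof -
  have "(\<Sum>z\<in>UNIV. \<chi> z) = (\<Sum>z\<in>UNIV. \<chi> (a * z))"
    by (rule sum.reindex_bij_witness[of _ "\<lambda>z. a * z" "\<lambda>z. z / a"]) (use assms in auto)
  also have "\<dots> = \<chi> a * (\<Sum>z\<in>UNIV. \<chi> z)"
    using assms by (simp add: mult_chars_mult sum_distrib_left)
  finally show ?thesis using assms(3) by simp
qed

text \<open>Multiplication by a character \<open>\<chi>\<close> with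
  \<open>\<chi> z \<noteq> 1\<close> permutes the character group and multiplies the sum by
  \<open>\<chi> z\<close>. At \<open>z = 0\<close> every term vanishes.\<close>

lemma sum_mult_chars_nontrivial:
  fixes z :: "'a :: {field, finite}"
  assumes "z \<noteq> 1"
  shows "(\<Sum>\<theta>\<in>mult_chars. \<theta> z) = 0"
proof (cases "z = 0")
  case False
  then obtain \<chi> where \<chi>: "\<chi> \<in> mult_chars" "\<chi> z \<noteq> 1"
    using mult_chars_separate assms by blast
  have "(\<Sum>\<theta>\<in>mult_chars. \<theta> z) = (\<Sum>\<theta>\<in>mult_chars. (\<chi> \<odot> \<theta>) z)"
  proof (rule sum.reindex_bij_witness[of _ "\<lambda>\<theta>. \<chi> \<odot> \<theta>" "\<lambda>\<theta>. char_inv \<chi> \<odot> \<theta>"])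
    fix \<theta> :: "'a \<Rightarrow> complex" assume \<theta>: "\<theta> \<in> mult_chars"
    \<comment> \<open>At \<open>w = 0\<close> nothing can be cancelled, but both sides vanish
      there.\<close>
    have "\<chi> w * (inverse (\<chi> w) * \<theta> w) = \<theta> w" for w
      using mult_chars_eq_0_iff[OF \<chi>(1), of w] mult_chars_zero[OF \<theta>] by (cases "w = 0") auto
    thus 1: "\<chi> \<odot> (char_inv \<chi> \<odot> \<theta>) = \<theta>" and 2: "char_inv \<chi> \<odot> (\<chi> \<odot> \<theta>) = \<theta>"
      by (simp_all add: fun_eq_iff char_mult_def char_inv_def mult.left_commute)
    show "\<chi> \<odot> \<theta> \<in> mult_chars" "char_inv \<chi> \<odot> \<theta> \<in> mult_chars"
      using \<chi>(1) \<theta> by blast+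
    show "(\<chi> \<odot> (char_inv \<chi> \<odot> \<theta>)) z = \<theta> z"
      by (simp only: 1)
  qed
  also have "\<dots> = \<chi> z * (\<Sum>\<theta>\<in>mult_chars. \<theta> z)"
    by (simp add: char_mult_def sum_distrib_left)
  finally show ?thesis using \<chi>(2) by simp
qed (simp add: mult_chars_zero)

text \<open>The sum of all entries of the character table, taken by columns and by rows.\<close>

lemma card_mult_chars:
  "of_nat (card (mult_chars :: ('a :: {field, finite} \<Rightarrow> complex) set)) = (of_nat CARD('a) - 1 :: complex)"
proof -
  let ?M = "mult_chars :: ('a \<Rightarrow> complex) set"
  have "of_nat (card ?M) = (\<Sum>z\<in>(UNIV :: 'a set). if z = 1 then of_nat (card ?M) else (0 :: complex))"
    by simp
  also have "\<dots> = (\<Sum>z\<in>(UNIV :: 'a set). \<Sum>\<theta>\<in>?M. \<theta> z)"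
    by (intro sum.cong) (auto simp: sum_mult_chars_nontrivial mult_chars_one)
  also have "\<dots> = (\<Sum>\<theta>\<in>?M. \<Sum>z\<in>(UNIV :: 'a set). \<theta> z)"
    by (rule sum.swap)
  also have "\<dots> = (\<Sum>\<theta>\<in>?M. if \<theta> = triv_char then (\<Sum>z\<in>(UNIV :: 'a set). triv_char z) else 0)"
  proof (intro sum.cong refl)
    fix \<theta> :: "'a \<Rightarrow> complex" assume \<theta>: "\<theta> \<in> ?M"
    show "(\<Sum>z\<in>(UNIV :: 'a set). \<theta> z) = (if \<theta> = triv_char then (\<Sum>z\<in>(UNIV :: 'a set). triv_char z) else 0)"
    proof (cases "\<theta> = triv_char")
      case False
      then obtain a where "a \<noteq> 0" "\<theta> a \<noteq> 1"
        using \<theta> by (force simp: triv_char_def mult_chars_zero)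
      thus ?thesis using sum_nontrivial_char[OF \<theta>] False by simp
    qed simp
  qed
  also have "\<dots> = (\<Sum>z\<in>(UNIV :: 'a set). triv_char z)"
    by (simp add: finite_mult_chars triv_char_in_mult_chars)
  also have "\<dots> = (\<Sum>z\<in>(UNIV :: 'a set). 1 - (if z = 0 then 1 else 0))"
    by (intro sum.cong) (auto simp: triv_char_def)
  also have "\<dots> = of_nat CARD('a) - 1"
    by (simp add: sum_subtractf)
  finally show ?thesis .
qed

lemma sum_mult_chars:
  fixes z :: "'a :: {field, finite}"
  shows "(\<Sum>\<theta>\<in>mult_chars. \<theta> z) = (if z = 1 then of_nat CARD('a) - 1 else 0)"
proof (cases "z = 1")
  case True
  have "(\<Sum>\<theta>\<in>mult_chars. \<theta> z) = (\<Sum>\<theta>\<in>(mult_chars :: ('a \<Rightarrow> complex) set). 1)"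
    by (intro sum.cong) (simp_all add: True mult_chars_one)
  thus ?thesis using True card_mult_chars[where 'a = 'a] by simp
qed (simp add: sum_mult_chars_nontrivial)

section \<open>The generating function\<close>

text \<open>The extra \<open>\<theta> (- 1)\<close>, supplied later by the prefactor of the Appell
  series, cancels the sign in the binomial coefficient. At \<open>w = 1\<close> both summands are 0,
  since division by 0 gives 0.\<close>

lemma char_binom_times_minus_one:
  assumes "\<theta> \<in> mult_chars"
  shows "char_binom (E \<odot> \<theta>) \<theta> * \<theta> (- 1) = (\<Sum>w\<in>UNIV. E w * \<theta> (w / (1 - w)))"
proof -
  have "char_binom (E \<odot> \<theta>) \<theta> * \<theta> (- 1) = (\<theta> (- 1) * \<theta> (- 1)) * jacobi_sum (E \<odot> \<theta>) (char_inv \<theta>)"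
    by (simp add: char_binom_def)
  also have "\<dots> = (\<Sum>w\<in>UNIV. E w * \<theta> (w / (1 - w)))"
    unfolding mult_chars_minus_one_square[OF assms] mult_chars_divide[OF assms]
    by (simp add: jacobi_sum_def char_mult_def char_inv_def divide_inverse mult.assoc)
  finally show ?thesis .
qed

text \<open>Clearing denominators leaves an equation linear in \<open>w\<close>. If its leading
  coefficient vanishes there is no solution, because \<open>u \<noteq> 1\<close>.\<close>

lemma mobius_product_eq_1_iff:
  fixes t u w :: "'a :: field"
  assumes "t \<noteq> 0" "u \<noteq> 0" "u \<noteq> 1"
  shows "w / (1 - w) * (u / (1 - u)) * t = 1 \<longleftrightarrow>
           1 - u * (1 - t) \<noteq> 0 \<and> w = (1 - u) / (1 - u * (1 - t))"
proof (cases "w = 1")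
  case True
  \<comment> \<open>For \<open>w = 1\<close> the left side of the equivalence reads
    \<open>0 = 1\<close> by division by 0, and \<open>u * t \<noteq> 0\<close> excludes this
    \<open>w\<close> on the right as well.\<close>
  have "1 - u \<noteq> 1 - u * (1 - t)" using assms by (simp add: algebra_simps)
  thus ?thesis using True by (auto simp: field_simps)
next
  case False
  have "w / (1 - w) * (u / (1 - u)) * t = 1 \<longleftrightarrow> w * u * t = (1 - w) * (1 - u)"
    using assms False by (simp add: divide_simps)
  also have "\<dots> \<longleftrightarrow> w * (1 - u * (1 - t)) = 1 - u"
    by (auto simp: algebra_simps)
  also have "\<dots> \<longleftrightarrow> 1 - u * (1 - t) \<noteq> 0 \<and> w = (1 - u) / (1 - u * (1 - t))"
    using assms by (cases "1 - u * (1 - t) = 0") (simp_all add: eq_divide_eq)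
  finally show ?thesis .
qed

text \<open>The common content of both identities; \<open>G\<close> abstracts the sum over the other variable.\<close>

lemma sum_binom_euler_integral:
  fixes B C :: "'a :: {field, finite} \<Rightarrow> complex" and G :: "'a \<Rightarrow> complex"
  assumes B: "B \<in> mult_chars" and C: "C \<in> mult_chars" and t: "t \<noteq> 0" "t \<noteq> 1"
  shows "(\<Sum>\<theta>\<in>mult_chars. char_binom (B \<odot> char_inv C \<odot> \<theta>) \<theta> * \<theta> (- 1) *
            (\<Sum>u\<in>UNIV. (B \<odot> \<theta>) u * (char_inv (B \<odot> \<theta>) \<odot> C) (1 - u) * G u) * \<theta> t)
         = (of_nat CARD('a) - 1) *
             (char_inv B (1 - t) * (\<Sum>u\<in>UNIV. B u * (char_inv B \<odot> C) (1 - u) * G (u / (1 - t)))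
              - (char_inv B \<odot> C) t * G 1)"
proof -
  define D where "D = char_inv B \<odot> C"
  define E where "E = B \<odot> char_inv C"
  \<comment> \<open>This \<open>q\<close> is the order of the multiplicative group, one less than
    the size of the field.\<close>
  define q :: complex where "q = of_nat CARD('a) - 1"
  have D: "D \<in> mult_chars" unfolding D_def using B C by blast
  have E: "E z = inverse (D z)" for z
    by (simp add: D_def E_def char_mult_def char_inv_def)
  have "(\<Sum>\<theta>\<in>mult_chars. char_binom (E \<odot> \<theta>) \<theta> * \<theta> (- 1) *
            (\<Sum>u\<in>UNIV. (B \<odot> \<theta>) u * (char_inv (B \<odot> \<theta>) \<odot> C) (1 - u) * G u) * \<theta> t)
      = (\<Sum>\<theta>\<in>mult_chars. \<Sum>u\<in>UNIV. \<Sum>w\<in>UNIV.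
           B u * D (1 - u) * G u * (E w * \<theta> (w / (1 - w) * (u / (1 - u)) * t)))"
  proof (intro sum.cong refl)
    fix \<theta> :: "'a \<Rightarrow> complex" assume \<theta>: "\<theta> \<in> mult_chars"
    have *: "(B \<odot> \<theta>) u * (char_inv (B \<odot> \<theta>) \<odot> C) (1 - u) * G u =
             B u * D (1 - u) * G u * \<theta> (u / (1 - u))" for u
      unfolding mult_chars_divide[OF \<theta>]
      by (simp add: D_def char_mult_def char_inv_def divide_inverse)
    show "char_binom (E \<odot> \<theta>) \<theta> * \<theta> (- 1) *
            (\<Sum>u\<in>UNIV. (B \<odot> \<theta>) u * (char_inv (B \<odot> \<theta>) \<odot> C) (1 - u) * G u) * \<theta> t
        = (\<Sum>u\<in>UNIV. \<Sum>w\<in>UNIV.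
           B u * D (1 - u) * G u * (E w * \<theta> (w / (1 - w) * (u / (1 - u)) * t)))"
      unfolding * char_binom_times_minus_one[OF \<theta>] mult_chars_mult[OF \<theta>]
      by (simp add: sum_distrib_left sum_distrib_right mult_ac)
  qed
  \<comment> \<open>The sum over \<open>\<theta>\<close> goes innermost, where orthogonality
    evaluates it.\<close>
  also have "\<dots> = (\<Sum>u\<in>UNIV. \<Sum>w\<in>UNIV. \<Sum>\<theta>\<in>mult_chars.
           B u * D (1 - u) * G u * (E w * \<theta> (w / (1 - w) * (u / (1 - u)) * t)))"
    by (subst sum.swap, rule sum.cong[OF refl], rule sum.swap)
  also have "\<dots> = (\<Sum>u\<in>UNIV. B u * D (1 - u) * G u *
           (\<Sum>w\<in>UNIV. E w * (if w / (1 - w) * (u / (1 - u)) * t = 1 then q else 0)))"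
    by (simp only: sum_distrib_left[symmetric] sum_mult_chars q_def)
  \<comment> \<open>At \<open>u = 1\<close> the old summand is 0 because \<open>D 0 = 0\<close>,
    whereas the new one would be \<open>D t * G 1\<close>; hence the correction.\<close>
  also have "\<dots> = (\<Sum>u\<in>UNIV. q * (B u * D (1 - u * (1 - t)) * G u - (if u = 1 then D t * G 1 else 0)))"
  proof (intro sum.cong refl)
    fix u :: 'a
    consider "u = 0" | "u = 1" | "u \<noteq> 0" "u \<noteq> 1" "1 - u * (1 - t) = 0"
      | "u \<noteq> 0" "u \<noteq> 1" "1 - u * (1 - t) \<noteq> 0" by blast
    thus "B u * D (1 - u) * G u *
           (\<Sum>w\<in>UNIV. E w * (if w / (1 - w) * (u / (1 - u)) * t = 1 then q else 0))
        = q * (B u * D (1 - u * (1 - t)) * G u - (if u = 1 then D t * G 1 else 0))"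
    proof cases
      case 3
      thus ?thesis
        unfolding mobius_product_eq_1_iff[OF t(1) 3(1,2)] by (simp add: mult_chars_zero[OF D])
    next
      case 4
      \<comment> \<open>Only this \<open>w\<close> survives; since \<open>E\<close> inverts
        \<open>D\<close>, the factor \<open>E ?w\<close> exchanges \<open>D (1 - u)\<close> for
        \<open>D (1 - u * (1 - t))\<close>.\<close>
      let ?w = "(1 - u) / (1 - u * (1 - t))"
      have "(\<Sum>w\<in>UNIV. E w * (if w / (1 - w) * (u / (1 - u)) * t = 1 then q else 0))
          = (\<Sum>w\<in>UNIV. if w = ?w then E w * q else 0)"
        unfolding mobius_product_eq_1_iff[OF t(1) 4(1,2)] using 4(3) by (intro sum.cong) simp_all
      also have "\<dots> = E ?w * q" by simp
      finally show ?thesis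
        using 4 D by (simp add: E mult_chars_divide[OF D] mult_chars_eq_0_iff)
    qed (simp_all add: mult_chars_zero[OF B] mult_chars_zero[OF D] mult_chars_one[OF B])
  qed
  also have "\<dots> = q * ((\<Sum>u\<in>UNIV. B u * D (1 - u * (1 - t)) * G u) - D t * G 1)"
    by (simp add: sum_subtractf flip: sum_distrib_left)
  also have "(\<Sum>u\<in>UNIV. B u * D (1 - u * (1 - t)) * G u)
           = (\<Sum>u\<in>UNIV. B (u / (1 - t)) * D (1 - u) * G (u / (1 - t)))"
    by (rule sum.reindex_bij_witness[of _ "\<lambda>u. u / (1 - t)" "\<lambda>u. u * (1 - t)"]) (use t in auto)
  also have "\<dots> = char_inv B (1 - t) * (\<Sum>u\<in>UNIV. B u * D (1 - u) * G (u / (1 - t)))"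
    unfolding mult_chars_divide[OF B]
    by (simp add: char_inv_def sum_distrib_left divide_inverse mult_ac)
  finally show ?thesis unfolding D_def E_def q_def .
qed

section \<open>Symmetry and generating function of the Appell series\<close>

text \<open>Isolating the sum over \<open>v\<close> provides the function \<open>G\<close> to which
  \<open>sum_binom_euler_integral\<close> is applied.\<close>

lemma appell_F2_iterated:
  "appell_F2 A B B' C C' x y =
     triv_char (x * y) * (B \<odot> B' \<odot> C \<odot> C') (- 1) *
     (\<Sum>u\<in>UNIV. B u * (char_inv B \<odot> C) (1 - u) *
       (\<Sum>v\<in>UNIV. B' v * (char_inv B' \<odot> C') (1 - v) * char_inv A (1 - u * x - v * y)))"
  unfolding appell_F2_def by (simp add: sum_distrib_left mult_ac)

lemma appell_F2_swap: "appell_F2 A B B' C C' x y = appell_F2 A B' B C' C y x"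
proof -
  have sign: "triv_char (x * y) * (B \<odot> B' \<odot> C \<odot> C') (- 1) =
      triv_char (y * x) * (B' \<odot> B \<odot> C' \<odot> C) (- 1)"
    by (simp add: char_mult_def mult_ac)
  have summand: "B u * B' v * (char_inv B \<odot> C) (1 - u) * (char_inv B' \<odot> C') (1 - v) *
        char_inv A (1 - u * x - v * y) =
      B' v * B u * (char_inv B' \<odot> C') (1 - v) * (char_inv B \<odot> C) (1 - u) *
        char_inv A (1 - v * y - u * x)" for u v
    unfolding cancel_ab_semigroup_add_class.diff_right_commute[of 1 "u * x"] by simp
  show ?thesis
    unfolding appell_F2_def sign summand by (rule arg_cong[OF sum.swap])
qed

lemma appell_F2_generating_function:
  fixes A B B' C C' :: "'a :: {field, finite} \<Rightarrow> complex" and x y t :: 'a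
  assumes A: "A \<in> mult_chars" and B: "B \<in> mult_chars" and C: "C \<in> mult_chars"
    and t: "t \<noteq> 1" and x: "x \<noteq> 1"
  shows "1 / (of_nat CARD('a) - 1) *
          (\<Sum>\<theta>\<in>mult_chars. char_binom (B \<odot> char_inv C \<odot> \<theta>) \<theta> *
             appell_F2 A (B \<odot> \<theta>) B' C C' x y * \<theta> t)
        = triv_char t * char_inv B (1 - t) * appell_F2 A B B' C C' (x / (1 - t)) y
          - (char_inv B \<odot> C) (- t) * triv_char x * char_inv A (1 - x) *
              hyp2F1 A B' C' (y / (1 - x))"
proof (cases "t = 0")
  case True
  \<comment> \<open>All characters vanish at 0, so both sides are 0.\<close>
  thus ?thesis by (simp add: triv_char_def char_mult_def mult_chars_zero[OF C] mult_chars_zero)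
next
  case False
  define q :: complex where "q = of_nat CARD('a) - 1"
  define G where "G u = (\<Sum>v\<in>UNIV. B' v * (char_inv B' \<odot> C') (1 - v) *
    char_inv A (1 - u * x - v * y))" for u
  define K where "K = triv_char (x * y) * (B \<odot> B' \<odot> C \<odot> C') (- 1)"
  define S where "S = (\<Sum>u\<in>UNIV. B u * (char_inv B \<odot> C) (1 - u) * G (u / (1 - t)))"
  have "card {0, 1 :: 'a} \<le> CARD('a)"
    by (rule card_mono) auto
  hence q: "q \<noteq> 0" by (simp add: q_def)
  \<comment> \<open>Twisting \<open>B\<close> by \<open>\<theta>\<close> contributes
    \<open>\<theta> (- 1)\<close> to the prefactor; the rest, \<open>K\<close>, is independent of
    \<open>\<theta>\<close>.\<close>
  have F: "appell_F2 A (B \<odot> \<theta>) B' C C' x y =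
      K * (\<theta> (- 1) * (\<Sum>u\<in>UNIV. (B \<odot> \<theta>) u * (char_inv (B \<odot> \<theta>) \<odot> C) (1 - u) * G u))" for \<theta>
    unfolding appell_F2_iterated K_def G_def by (simp add: char_mult_def)
  have "(\<Sum>\<theta>\<in>mult_chars. char_binom (B \<odot> char_inv C \<odot> \<theta>) \<theta> *
             appell_F2 A (B \<odot> \<theta>) B' C C' x y * \<theta> t)
      = K * (\<Sum>\<theta>\<in>mult_chars. char_binom (B \<odot> char_inv C \<odot> \<theta>) \<theta> * \<theta> (- 1) *
            (\<Sum>u\<in>UNIV. (B \<odot> \<theta>) u * (char_inv (B \<odot> \<theta>) \<odot> C) (1 - u) * G u) * \<theta> t)"
    unfolding F by (subst sum_distrib_left) (simp add: mult_ac)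
  also have "\<dots> = K * (q * (char_inv B (1 - t) * S - (char_inv B \<odot> C) t * G 1))"
    unfolding sum_binom_euler_integral[OF B C False t] q_def S_def ..
  finally have lhs: "1 / q * (\<Sum>\<theta>\<in>mult_chars. char_binom (B \<odot> char_inv C \<odot> \<theta>) \<theta> *
             appell_F2 A (B \<odot> \<theta>) B' C C' x y * \<theta> t)
      = K * (char_inv B (1 - t) * S - (char_inv B \<odot> C) t * G 1)"
    using q by simp
  \<comment> \<open>Dividing \<open>x\<close> by the nonzero \<open>1 - t\<close> leaves
    \<open>triv_char (x * y)\<close> unchanged, so the prefactor is again \<open>K\<close>.\<close>
  have F2: "appell_F2 A B B' C C' (x / (1 - t)) y = K * S"
    using t unfolding appell_F2_iterated K_def S_def G_def by (simp add: triv_char_def)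
  \<comment> \<open>As \<open>x \<noteq> 1\<close>, the factor \<open>1 - x\<close> can be pulled
    out of \<open>1 - x - v * y\<close>, which leaves the sum defining \<open>hyp2F1\<close> at
    \<open>y / (1 - x)\<close>.\<close>
  have G1: "G 1 = char_inv A (1 - x) *
      (\<Sum>v\<in>UNIV. B' v * (char_inv B' \<odot> C') (1 - v) * char_inv A (1 - y / (1 - x) * v))"
  proof -
    have "char_inv A (1 - 1 * x - v * y) = char_inv A (1 - x) * char_inv A (1 - y / (1 - x) * v)" for v
    proof -
      have "1 - 1 * x - v * y = (1 - x) * (1 - y / (1 - x) * v)"
        using x by (simp add: field_simps)
      thus ?thesis using A by (simp only: mult_chars_mult[OF char_inv_in_mult_chars])
    qed
    thus ?thesis unfolding G_def by (simp add: sum_distrib_left mult_ac)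
  qed
  \<comment> \<open>\<open>B (- 1)\<close> is its own inverse. Thus \<open>K\<close> gives up its
    factor \<open>(B \<odot> C) (- 1)\<close> and keeps the sign required by
    \<open>hyp2F1\<close>.\<close>
  have sign: "(char_inv B \<odot> C) (- t) = (B \<odot> C) (- 1) * (char_inv B \<odot> C) t"
    using mult_chars_mult[OF B, of "- 1" t] mult_chars_mult[OF C, of "- 1" t]
    by (simp add: char_mult_def char_inv_def inverse_mult_chars_minus_one[OF B])
  have "K * (char_inv B \<odot> C) t * G 1 =
      (char_inv B \<odot> C) (- t) * triv_char x * char_inv A (1 - x) * hyp2F1 A B' C' (y / (1 - x))"
    unfolding G1 K_def hyp2F1_def sign using x
    by (simp add: triv_char_def char_mult_def)
  moreover have "triv_char t = 1"
    using False by (simp add: triv_char_def)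
  ultimately show ?thesis
    unfolding lhs[unfolded q_def] F2 by (simp add: right_diff_distrib mult_ac)
qed

theorem theorem4p2:
  fixes A B B' C C' :: "'a :: {field, finite} \<Rightarrow> complex" and x y t :: 'a
  assumes "A \<in> mult_chars" and "B \<in> mult_chars" and "B' \<in> mult_chars"
    and "C \<in> mult_chars" and "C' \<in> mult_chars"
    and "t \<noteq> 1"
  shows
    "(x \<noteq> 1 \<longrightarrow>
        1 / (of_nat CARD('a) - 1) *
          (\<Sum>\<theta>\<in>mult_chars. char_binom (B \<odot> char_inv C \<odot> \<theta>) \<theta> *
             appell_F2 A (B \<odot> \<theta>) B' C C' x y * \<theta> t)
        = triv_char t * char_inv B (1 - t) * appell_F2 A B B' C C' (x / (1 - t)) y
          - (char_inv B \<odot> C) (- t) * triv_char x * char_inv A (1 - x) *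
              hyp2F1 A B' C' (y / (1 - x)))
     \<and>
     (y \<noteq> 1 \<longrightarrow>
        1 / (of_nat CARD('a) - 1) *
          (\<Sum>\<theta>\<in>mult_chars. char_binom (B' \<odot> char_inv C' \<odot> \<theta>) \<theta> *
             appell_F2 A B (B' \<odot> \<theta>) C C' x y * \<theta> t)
        = triv_char t * char_inv B' (1 - t) * appell_F2 A B B' C C' x (y / (1 - t))
          - (char_inv B' \<odot> C') (- t) * triv_char y * char_inv A (1 - y) *
              hyp2F1 A B C (x / (1 - y)))"
  \<comment> \<open>The second identity is the first with the variables exchanged. Fixing the order
    of \<open>C\<close> and \<open>C'\<close> keeps the symmetry from undoing itself as a rewrite
    rule.\<close>
  using appell_F2_generating_function[OF assms(1,2,4,6), of x B' C' y]
    appell_F2_generating_function[OF assms(1,3,5,6), of y B C x]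
  by (simp add: appell_F2_swap[of A _ B' C C'] appell_F2_swap[of A B _ C C'])

end
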